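(* Let $\langle\mathcal S,P,c,\alpha\rangle$ be a Markov reward process on a finite state space $\mathcal S$ with value $V$. Let $(G,U)$ be a coarse grid aggregation scheme with meta-states $\mathcal M$ and representative states $\{x_l:l\in\mathcal M\}$, and let $\widetilde V$ be the value of $\langle\mathcal S,\widetilde P,c,\alpha\rangle$, where $\widetilde P=PGU$ is the $(G,U)$-lifted chain. Let $W(l)=V(x_l)$ and $\widetilde W(l)=\widetilde V(x_l)$ for $l\in\mathcal M$. Then $$|V-\widetilde V|^*_{\mathcal S}\le\frac{1}{1-\alpha}\Big(|V-GW|^*_{\mathcal S}+|\widetilde V-G\widetilde W|^*_{\mathcal S}\Big).$$
   Context: A Markov reward process $\langle\mathcal S,P,c,\alpha\rangle$ consists of a finite state space $\mathcal S\subseteq\mathbb Z^d\cap\times_{i=1}^d[\ell_i,u_i]$, a transition matrix $P=(p_{xy})$ on $\mathcal S$, a cost function $c:\mathcal S\to\mathbb R_+$ (in the paper also norm-like: for some $k\in\mathbb Z_+$ and $\Gamma>0$, $\frac1\Gamma\|x\|^k\le c(x)\le\Gamma(1+\|x\|)^k$), and a discount factor $\alpha\in(0,1)$. Its value is $V(x)=\mathbb E_x\big[\sum_{t=0}^\infty\alpha^tc(X_t)\big]$, the unique solution of $V=c+\alpha PV$. Aggregation: $\mathcal M=\{1,\dots,L\}$, $L\le|\mathcal S|$, is a set of meta-states; $G=(g_{xl})$ is an $|\mathcal S|\times L$ non-negative row-stochastic matrix and $U=(u_{lx})$ is an $L\times|\mathcal S|$ non-negative row-stochastic matrix. A coarse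 grid scheme is one in which $U$ is binary: each meta-state $l$ has a representative state $x_l\in\mathcal S$ with $u_{lx_l}=1$ (and $u_{lx}=0$ for $x\ne x_l$), meta-states being in one-to-one correspondence with their representative states, while $G$ is allowed to be a general stochastic matrix. Thus $(GW)(y)=\sum_lg_{yl}V(x_l)$ and $(G\widetilde W)(y)=\sum_lg_{yl}\widetilde V(x_l)$. For $f:\mathcal S\to\mathbb R$, $|f|^*_{\mathcal S}=\sup_{x\in\mathcal S}|f(x)|$. *)

theory Defs
  imports "HOL-Probability.Probability"
begin

text \<open>Matrices are functions of two indices; only the entries whose indices lie in the stated
  index sets are meaningful.\<close>

definition row_stochastic :: "'i set \<Rightarrow> 'j set \<Rightarrow> ('i \<Rightarrow> 'j \<Rightarrow> real) \<Rightarrow> bool" where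
  "row_stochastic I J A \<longleftrightarrow> (\<forall>i\<in>I. (\<forall>j\<in>J. 0 \<le> A i j) \<and> (\<Sum>j\<in>J. A i j) = 1)"

definition mat_prod :: "'j set \<Rightarrow> ('i \<Rightarrow> 'j \<Rightarrow> real) \<Rightarrow> ('j \<Rightarrow> 'k \<Rightarrow> real) \<Rightarrow> 'i \<Rightarrow> 'k \<Rightarrow> real" where
  "mat_prod J A B i k = (\<Sum>j\<in>J. A i j * B j k)"

definition mat_app :: "'j set \<Rightarrow> ('i \<Rightarrow> 'j \<Rightarrow> real) \<Rightarrow> ('j \<Rightarrow> real) \<Rightarrow> 'i \<Rightarrow> real" where
  "mat_app J A f i = (\<Sum>j\<in>J. A i j * f j)"

definition sup_norm_on :: "'s set \<Rightarrow> ('s \<Rightarrow> real) \<Rightarrow> real" where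
  "sup_norm_on S f = (SUP x\<in>S. \<bar>f x\<bar>)"

text \<open>The law on the path space \<open>S\<^sup>\<nat>\<close> of the Markov chain with transition matrix \<open>P\<close> started
  in \<open>x\<close>: the projective limit given by the Ionescu-Tulcea theorem for the kernels that set
  \<open>X\<^sub>0 = x\<close> and draw \<open>X\<^sub>n\<close> from row \<open>X\<^sub>n\<^sub>-\<^sub>1\<close> of \<open>P\<close>.\<close>

definition chain_kernel ::
    "'s set \<Rightarrow> ('s \<Rightarrow> 's \<Rightarrow> real) \<Rightarrow> 's \<Rightarrow> nat \<Rightarrow> (nat \<Rightarrow> 's) \<Rightarrow> 's measure" where
  "chain_kernel S P x n h =
     (if n = 0 then return (count_space S) x
      else point_measure S (\<lambda>y. ennreal (P (h (n - 1)) y)))"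

definition path_law :: "'s set \<Rightarrow> ('s \<Rightarrow> 's \<Rightarrow> real) \<Rightarrow> 's \<Rightarrow> (nat \<Rightarrow> 's) measure" where
  "path_law S P x =
     projective_family.lim UNIV
       (Ionescu_Tulcea.CI (chain_kernel S P x) (\<lambda>_. count_space S)) (\<lambda>_. count_space S)"

definition mrp_value ::
    "'s set \<Rightarrow> ('s \<Rightarrow> 's \<Rightarrow> real) \<Rightarrow> ('s \<Rightarrow> real) \<Rightarrow> real \<Rightarrow> 's \<Rightarrow> real" where
  "mrp_value S P c \<alpha> x = (\<integral>\<omega>. (\<Sum>t. \<alpha> ^ t * c (\<omega> t)) \<partial>path_law S P x)"

definition markov_reward_process ::
    "(int ^ 'd) set \<Rightarrow> (int ^ 'd \<Rightarrow> int ^ 'd \<Rightarrow> real) \<Rightarrow> (int ^ 'd \<Rightarrow> real) \<Rightarrow> real \<Rightarrow> bool" where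
  "markov_reward_process S P c \<alpha> \<longleftrightarrow>
     finite S \<and> S \<noteq> {} \<and>
     (\<exists>lo up. \<forall>x\<in>S. \<forall>i. lo $ i \<le> x $ i \<and> x $ i \<le> up $ i) \<and>
     row_stochastic S S P \<and> (\<forall>x\<in>S. 0 \<le> c x) \<and> 0 < \<alpha> \<and> \<alpha> < 1"

definition aggregation_scheme ::
    "'s set \<Rightarrow> nat \<Rightarrow> ('s \<Rightarrow> nat \<Rightarrow> real) \<Rightarrow> (nat \<Rightarrow> 's \<Rightarrow> real) \<Rightarrow> bool" where
  "aggregation_scheme S L G U \<longleftrightarrow>
     L \<le> card S \<and> row_stochastic S {1..L} G \<and> row_stochastic {1..L} S U"

definition coarse_grid_scheme ::
    "'s set \<Rightarrow> nat \<Rightarrow> ('s \<Rightarrow> nat \<Rightarrow> real) \<Rightarrow> (nat \<Rightarrow> 's \<Rightarrow> real) \<Rightarrow> (nat \<Rightarrow> 's) \<Rightarrow> bool" where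
  "coarse_grid_scheme S L G U rep \<longleftrightarrow>
     aggregation_scheme S L G U \<and> rep ` {1..L} \<subseteq> S \<and> inj_on rep {1..L} \<and>
     (\<forall>l\<in>{1..L}. \<forall>x\<in>S. U l x = (if x = rep l then 1 else 0))"

definition lifted_chain ::
    "'s set \<Rightarrow> nat \<Rightarrow> ('s \<Rightarrow> 's \<Rightarrow> real) \<Rightarrow> ('s \<Rightarrow> nat \<Rightarrow> real) \<Rightarrow> (nat \<Rightarrow> 's \<Rightarrow> real) \<Rightarrow> 's \<Rightarrow> 's \<Rightarrow> real" where
  "lifted_chain S L P G U = mat_prod {1..L} (mat_prod S P G) U"

lemma Ionescu_Tulcea_chain_kernel:
  fixes S :: "'s set"
  assumes S: "finite S" and P: "row_stochastic S S P" and x: "x \<in> S"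
  shows "Ionescu_Tulcea (chain_kernel S P x) (\<lambda>_. count_space S)"
proof -
  have ps: "prob_space (point_measure S (\<lambda>y. ennreal (P z y)))" if "z \<in> S" for z
  proof
    have "emeasure (point_measure S (\<lambda>y. ennreal (P z y))) S = (\<Sum>y\<in>S. ennreal (P z y))"
      using S by (simp add: emeasure_point_measure_finite)
    also have "\<dots> = 1"
      using P that by (simp add: row_stochastic_def sum_ennreal)
    finally show "emeasure (point_measure S (\<lambda>y. ennreal (P z y)))
        (space (point_measure S (\<lambda>y. ennreal (P z y)))) = 1"
      by (simp add: space_point_measure)
  qed
  show ?thesis
  proof (rule Ionescu_Tulcea.intro)
    fix i :: nat
    show "chain_kernel S P x i \<in> measurable (PiM {0..<i} (\<lambda>_. count_space S)) (subprob_algebra (count_space S))"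
    proof (cases i)
      case 0
      then show ?thesis
        using x by (auto simp: chain_kernel_def[abs_def] intro!: measurable_const return_measurable[THEN measurable_space])
    next
      case (Suc n)
      have 1: "(\<lambda>h. h n) \<in> measurable (PiM {0..<i} (\<lambda>_. count_space S)) (count_space S)"
        using Suc by (intro measurable_component_singleton) auto
      have 2: "(\<lambda>z. point_measure S (\<lambda>y. ennreal (P z y))) \<in>
          measurable (count_space S) (subprob_algebra (count_space S))"
        using ps by (auto simp: space_subprob_algebra sets_point_measure intro: prob_space_imp_subprob_space)
      show ?thesis
        using measurable_compose[OF 1 2] Suc by (simp add: chain_kernel_def[abs_def])
    qed
  next
    fix i and h :: "nat \<Rightarrow> 's"
    assume h: "h \<in> space (PiM {0..<i} (\<lambda>_. count_space S))"
    show "prob_space (chain_kernel S P x i h)"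
    proof (cases i)
      case 0
      then show ?thesis using x by (simp add: chain_kernel_def prob_space_return)
    next
      case (Suc n)
      then have "h n \<in> S" using h by (auto simp: space_PiM PiE_iff)
      then show ?thesis using Suc ps by (simp add: chain_kernel_def)
    qed
  qed
qed

lemma emeasure_path_law_cylinder:
  fixes S :: "'s set"
  assumes S: "finite S" and P: "row_stochastic S S P" and x: "x \<in> S"
    and h: "\<And>i. i \<le> n \<Longrightarrow> h i \<in> S"
  shows "emeasure (path_law S P x) {\<omega> \<in> space (path_law S P x). \<forall>i\<le>n. \<omega> i = h i} =
    ennreal ((if h 0 = x then 1 else 0) * (\<Prod>i<n. P (h i) (h (Suc i))))"
proof -
  interpret IT: Ionescu_Tulcea "chain_kernel S P x" "\<lambda>_. count_space S"
    by (rule Ionescu_Tulcea_chain_kernel[OF S P x])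
  have pos: "0 \<le> P y z" if "y \<in> S" "z \<in> S" for y z
    using P that by (simp add: row_stochastic_def)
  let ?M = "\<lambda>_::nat. count_space S" and ?u = "\<lambda>_::nat. undefined :: 's"
  define r where "r m = restrict h {0..<m}" for m :: nat
  have sing: "{r m} \<in> sets (PiM {0..<m} ?M)" if "m \<le> Suc n" for m
  proof -
    have "{r m} = PiE {0..<m} (\<lambda>i. {h i})"
      by (auto simp: r_def PiE_iff extensional_def fun_eq_iff)
    also have "\<dots> \<in> sets (PiM {0..<m} ?M)"
      using h that by (intro sets_PiM_I_finite) auto
    finally show ?thesis .
  qed
  have step: "emeasure (IT.eP m \<omega>) {r (Suc m)} =
      emeasure (chain_kernel S P x m \<omega>) {h m} * indicator {r m} \<omega>"
    if \<omega>: "\<omega> \<in> space (PiM {0..<m} ?M)" and m: "m \<le> n" for m \<omega>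
  proof -
    have "emeasure (IT.eP m \<omega>) {r (Suc m)} =
        emeasure (chain_kernel S P x m \<omega>) ((\<lambda>z. fun_upd \<omega> m z) -` {r (Suc m)} \<inter> S)"
      using IT.emeasure_eP[OF \<omega> sing[of "Suc m"]] m by simp
    also have "(\<lambda>z. fun_upd \<omega> m z) -` {r (Suc m)} \<inter> S =
        (if \<omega> = r m then {h m} else {})"
    proof -
      have upd: "fun_upd \<omega> m z = r (Suc m) \<longleftrightarrow> z = h m \<and> \<omega> = r m" for z
      proof
        assume eq: "fun_upd \<omega> m z = r (Suc m)"
        have "\<omega> i = r m i" for i
        proof -
          have "i \<noteq> m \<Longrightarrow> \<omega> i = (if i < Suc m then h i else undefined)"
            using fun_cong[OF eq, of i] by (simp add: r_def)
          moreover have "\<not> i < m \<Longrightarrow> \<omega> i = undefined"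
            using \<omega> by (simp add: space_PiM PiE_iff extensional_def)
          ultimately show ?thesis
            by (cases "i < m") (simp_all add: r_def)
        qed
        then show "z = h m \<and> \<omega> = r m"
          using fun_cong[OF eq, of m] by (auto simp: r_def)
      qed (auto simp: r_def fun_eq_iff)
      show ?thesis unfolding vimage_def singleton_iff upd using h[OF m] by auto
    qed
    finally show ?thesis
      by (cases "\<omega> = r m") simp_all
  qed
  have C: "emeasure (IT.C 0 (Suc m) ?u) {r (Suc m)} =
     ennreal ((if h 0 = x then 1 else 0) * (\<Prod>i<m. P (h i) (h (Suc i))))" if "m \<le> n" for m
    using that
  proof (induction m)
    case 0
    have "emeasure (IT.C 0 (Suc 0) ?u) {r (Suc 0)} =
        emeasure (IT.eP 0 ?u) {r (Suc 0)}"
      using bind_return[OF IT.measurable_eP[of 0], of ?u] by simp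
    also have "\<dots> = emeasure (return (count_space S) x) {h 0}"
      using step[of ?u 0] by (simp add: chain_kernel_def r_def fun_eq_iff)
    finally show ?case using h[of 0] by (simp add: indicator_def)
  next
    case (Suc m)
    have u: "?u \<in> space (PiM {0..<0} ?M)" by simp
    let ?C = "IT.C 0 (Suc m) ?u" and ?p = "ennreal (P (h m) (h (Suc m)))"
    have "emeasure (IT.C 0 (Suc (Suc m)) ?u) {r (Suc (Suc m))} =
        (\<integral>\<^sup>+\<omega>. emeasure (IT.eP (Suc m) \<omega>) {r (Suc (Suc m))} \<partial>?C)"
      unfolding IT.C.simps(2)[of 0 "Suc m"]
      using emeasure_bind[of ?C "IT.eP (Suc m)" "PiM {0..<Suc (Suc m)} ?M"]
        IT.measurable_eP[of "Suc m"] sing[of "Suc (Suc m)"] Suc.prems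
        prob_space.not_empty[OF IT.prob_space_C[OF u]]
      by (simp only: measurable_cong_sets[OF IT.sets_C[OF u] refl] add_0 order_refl not_False_eq_True)
    also have "\<dots> = (\<integral>\<^sup>+\<omega>. ?p * indicator {r (Suc m)} \<omega> \<partial>?C)"
    proof (rule nn_integral_cong)
      fix \<omega> assume "\<omega> \<in> space ?C"
      then have \<omega>: "\<omega> \<in> space (PiM {0..<Suc m} ?M)"
        using IT.space_C[OF u, of "Suc m"] by simp
      show "emeasure (IT.eP (Suc m) \<omega>) {r (Suc (Suc m))} =
          ?p * indicator {r (Suc m)} \<omega>"
        using step[OF \<omega> Suc.prems] h[OF Suc.prems] S
        by (auto simp: r_def chain_kernel_def emeasure_point_measure_finite split: split_indicator)
    qed
    also have "\<dots> = ?p * emeasure ?C {r (Suc m)}"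
      using sing[of "Suc m"] Suc.prems IT.sets_C[OF u, of "Suc m"]
      by (intro nn_integral_cmult_indicator) simp
    also have "\<dots> = ?p * ennreal ((if h 0 = x then 1 else 0) * (\<Prod>i<m. P (h i) (h (Suc i))))"
      using Suc by simp
    also have "\<dots> = ennreal ((if h 0 = x then 1 else 0) * (\<Prod>i<Suc m. P (h i) (h (Suc i))))"
      using Suc.prems h pos by (subst ennreal_mult[symmetric]) (auto intro!: prod_nonneg simp: mult_ac)
    finally show ?case .
  qed
  let ?J = "{0..<Suc n}" and ?X = "{r (Suc n)}"
  have path: "path_law S P x = IT.PF.lim"
    by (simp add: path_law_def)
  have "{\<omega> \<in> space (path_law S P x). \<forall>i\<le>n. \<omega> i = h i} = IT.PF.emb UNIV ?J ?X"
    by (auto simp: path IT.PF.space_lim r_def prod_emb_def space_PiM fun_eq_iff restrict_def less_Suc_eq_le) metis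
  then have "emeasure (path_law S P x) {\<omega> \<in> space (path_law S P x). \<forall>i\<le>n. \<omega> i = h i} =
      emeasure (IT.C 0 (Suc n) ?u) (IT.PF.emb ?J ?J ?X)"
    using sing[of "Suc n"] by (simp add: path IT.lim IT.emeasure_CI[of ?J "Suc n"] del: IT.C.simps)
  also have "IT.PF.emb ?J ?J ?X = ?X"
    using sets.sets_into_space[OF sing[of "Suc n"]] by (intro prod_emb_id) (simp add: space_PiM)
  finally show ?thesis
    using C[of n] by simp
qed

end

theory Submission
  imports Defs
begin

text \<open>
  By the Markov property both values solve Bellman equations, and since \<open>U\<close> only reads off
  representative states, that of \<open>Vt\<close> is \<open>Vt = c + \<alpha> P G Wt\<close>. Hence
  \<open>V - Vt = \<alpha> P ((V - G W) + G (W - Wt))\<close>, where \<open>P\<close> and \<open>G\<close> do not increase the sup norm and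
  \<open>W - Wt\<close> is a restriction of \<open>V - Vt\<close>. So \<open>D = |V - Vt|\<close> satisfies
  \<open>D \<le> \<alpha> (|V - G W| + D)\<close>.
\<close>

section \<open>Stochastic matrices as operators, and the sup norm\<close>

lemma abs_mat_app_le:
  assumes "row_stochastic I J A" "i \<in> I" "\<And>j. j \<in> J \<Longrightarrow> \<bar>f j\<bar> \<le> B"
  shows "\<bar>mat_app J A f i\<bar> \<le> B"
proof -
  have "\<bar>mat_app J A f i\<bar> \<le> (\<Sum>j\<in>J. \<bar>A i j * f j\<bar>)"
    unfolding mat_app_def by (rule sum_abs)
  also have "\<dots> \<le> (\<Sum>j\<in>J. A i j * B)"
    using assms by (intro sum_mono) (auto simp: abs_mult row_stochastic_def intro!: mult_left_mono)
  also have "\<dots> = B"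
    using assms by (simp add: row_stochastic_def flip: sum_distrib_right)
  finally show ?thesis .
qed

lemma mat_app_cong: "(\<And>j. j \<in> J \<Longrightarrow> f j = g j) \<Longrightarrow> mat_app J A f i = mat_app J A g i"
  by (simp add: mat_app_def)

lemma mat_app_diff: "mat_app J A (\<lambda>j. f j - g j) i = mat_app J A f i - mat_app J A g i"
  by (simp add: mat_app_def algebra_simps sum_subtractf)

text \<open>Associativity lets the lifted chain act as \<open>U\<close>, then \<open>G\<close>, then
  \<open>P\<close>.\<close>

lemma mat_app_mat_prod: "mat_app K (mat_prod J A B) f i = mat_app J A (mat_app K B f) i"
  by (simp add: mat_app_def mat_prod_def sum_distrib_left sum_distrib_right mult.assoc)
     (rule sum.swap)

text \<open>Row sums are the operator's values at the constant function 1, which each factor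
  fixes.\<close>

lemma row_stochastic_mat_prod:
  assumes "row_stochastic I J A" "row_stochastic J K B"
  shows "row_stochastic I K (mat_prod J A B)"
proof -
  have "(\<Sum>k\<in>K. mat_prod J A B i k) = 1" if "i \<in> I" for i
  proof -
    have "(\<Sum>k\<in>K. mat_prod J A B i k) = mat_app J A (mat_app K B (\<lambda>_. 1)) i"
      unfolding mat_app_mat_prod[symmetric] by (simp add: mat_app_def)
    also have "\<dots> = mat_app J A (\<lambda>_. 1) i"
      using assms by (intro mat_app_cong) (simp add: mat_app_def row_stochastic_def)
    also have "\<dots> = 1"
      using assms that by (simp add: mat_app_def row_stochastic_def)
    finally show ?thesis .
  qed
  then show ?thesis
    using assms by (auto simp: row_stochastic_def mat_prod_def intro!: sum_nonneg)
qed

lemma abs_le_sup_norm_on: "finite S \<Longrightarrow> x \<in> S \<Longrightarrow> \<bar>f x\<bar> \<le> sup_norm_on S f"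
  unfolding sup_norm_on_def by (intro cSUP_upper bdd_above_finite) auto

lemma sup_norm_on_le: "S \<noteq> {} \<Longrightarrow> (\<And>x. x \<in> S \<Longrightarrow> \<bar>f x\<bar> \<le> B) \<Longrightarrow> sup_norm_on S f \<le> B"
  unfolding sup_norm_on_def by (rule cSUP_least)

lemma sup_norm_on_nonneg: "finite S \<Longrightarrow> S \<noteq> {} \<Longrightarrow> 0 \<le> sup_norm_on S f"
  using abs_le_sup_norm_on[of S _ f] by (meson abs_ge_zero all_not_in_conv order_trans)

section \<open>Expectations under the path law of the chain\<close>

context
  fixes S :: "'s set" and P :: "'s \<Rightarrow> 's \<Rightarrow> real" and x :: 's
  assumes S: "finite S" and P: "row_stochastic S S P" and x: "x \<in> S"
begin

lemma sets_path_law: "sets (path_law S P x) = sets (PiM UNIV (\<lambda>_. count_space S))"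
proof -
  interpret IT: Ionescu_Tulcea "chain_kernel S P x" "\<lambda>_. count_space S"
    by (rule Ionescu_Tulcea_chain_kernel[OF S P x])
  show ?thesis by (simp add: path_law_def)
qed

lemma space_path_law: "space (path_law S P x) = UNIV \<rightarrow>\<^sub>E S"
  by (simp add: sets_eq_imp_space_eq[OF sets_path_law] space_PiM)

text \<open>The marginal on the empty index set is a probability measure, and a pushforward has the
  same total mass as its source.\<close>

lemma prob_space_path_law: "prob_space (path_law S P x)"
proof -
  interpret IT: Ionescu_Tulcea "chain_kernel S P x" "\<lambda>_. count_space S"
    by (rule Ionescu_Tulcea_chain_kernel[OF S P x])
  have "prob_space (distr IT.PF.lim (PiM {} (\<lambda>_. count_space S)) (\<lambda>\<omega>. restrict \<omega> {}))"
    unfolding IT.distr_lim[OF finite.emptyI] by (rule IT.PF.prob_space_P) auto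
  moreover have "(\<lambda>\<omega>. restrict \<omega> {}) \<in> measurable IT.PF.lim (PiM {} (\<lambda>_. count_space S))"
    unfolding measurable_cong_sets[OF IT.PF.sets_lim refl] by (rule measurable_restrict_subset) simp
  ultimately show ?thesis
    unfolding path_law_def by (rule prob_space_distrD[rotated])
qed

interpretation prob_space "path_law S P x" by (rule prob_space_path_law)

lemma path_law_in_S: "\<omega> \<in> space (path_law S P x) \<Longrightarrow> \<omega> n \<in> S"
  by (auto simp: space_path_law)

lemma measurable_path_law_component [measurable]:
  "(\<lambda>\<omega>. \<omega> n) \<in> measurable (path_law S P x) (count_space S)"
  unfolding measurable_cong_sets[OF sets_path_law refl]
  by (rule measurable_component_singleton) simp

lemma measurable_path_law_cost [measurable]:
  "(\<lambda>\<omega>. f (\<omega> n) :: real) \<in> borel_measurable (path_law S P x)"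
  by (rule measurable_compose[OF measurable_path_law_component]) simp

lemma integrable_path_law_cost [simp]:
  "integrable (path_law S P x) (\<lambda>\<omega>. f (\<omega> n) :: real)"
  using S path_law_in_S
  \<comment> \<open>\<open>f\<close> is arbitrary, but paths stay in the finite set
    \<open>S\<close>, so the sum of \<open>\<bar>f y\<bar>\<close> over \<open>S\<close> dominates
    every \<open>\<bar>f (\<omega> n)\<bar>\<close>.\<close>
  by (intro integrable_const_bound[where B = "\<Sum>y\<in>S. \<bar>f y\<bar>"])
     (auto intro!: AE_I2 member_le_sum)

text \<open>The bound is inclusive: \<open>cyl m h\<close> fixes \<open>m + 1\<close> coordinates,
  and \<open>cyl 0 h\<close> only the initial state.\<close>

abbreviation cyl :: "nat \<Rightarrow> (nat \<Rightarrow> 's) \<Rightarrow> (nat \<Rightarrow> 's) set" where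
  "cyl m h \<equiv> {\<omega> \<in> space (path_law S P x). \<forall>i\<le>m. \<omega> i = h i}"

lemma cyl_sets [measurable]: "cyl m h \<in> sets (path_law S P x)"
proof (cases "\<forall>i\<le>m. h i \<in> S")
  \<comment> \<open>\<open>{h i}\<close> is an event of \<open>count_space S\<close> only if
    \<open>h i \<in> S\<close>; if some \<open>h i\<close> with \<open>i \<le> m\<close> leaves
    \<open>S\<close>, the cylinder is empty.\<close>
  case True
  have "{\<omega> \<in> space (path_law S P x). \<omega> i = h i} \<in> sets (path_law S P x)" if "i \<le> m" for i
    using measurable_sets[OF measurable_path_law_component, of "{h i}" i] True that
    by (simp add: vimage_def Int_def conj_commute)
  then have "{\<omega> \<in> space (path_law S P x). \<forall>i\<in>{..m}. \<omega> i = h i} \<in> sets (path_law S P x)"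
    by (intro sets.sets_Collect_finite_All') auto
  then show ?thesis by simp
next
  case False
  then obtain i where i: "i \<le> m" "h i \<notin> S" by blast
  have "\<omega> \<notin> cyl m h" for \<omega>
    using path_law_in_S[of \<omega> i] i by force
  then have empty: "cyl m h = {}" by blast
  show ?thesis unfolding empty by (rule sets.empty_sets)
qed

lemma integrable_path_law_cyl [simp]:
  "integrable (path_law S P x) (\<lambda>\<omega>. indicator (cyl m h) \<omega> * f (\<omega> n) :: real)"
  using integrable_mult_indicator[OF cyl_sets integrable_path_law_cost, of m h f n]
  unfolding real_scaleR_def .

text \<open>Induction backwards in time: conditioning on one more coordinate of the path replaces
  \<open>f\<close> by \<open>P f\<close>.\<close>

lemma integral_path_law_cyl:
  assumes "\<And>i. i \<le> m \<Longrightarrow> h i \<in> S"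
  shows "(\<integral>\<omega>. indicator (cyl m h) \<omega> * f (\<omega> (m + k)) \<partial>path_law S P x) =
    (if h 0 = x then 1 else 0) * (\<Prod>i<m. P (h i) (h (Suc i))) * ((mat_app S P ^^ k) f (h m))"
  using assms
proof (induction k arbitrary: m h)
  case 0
  have "0 \<le> (\<Prod>i<m. P (h i) (h (Suc i)))"
    using 0 P by (intro prod_nonneg) (auto simp: row_stochastic_def)
  then have meas: "measure (path_law S P x) (cyl m h) =
      (if h 0 = x then 1 else 0) * (\<Prod>i<m. P (h i) (h (Suc i)))"
    by (simp add: measure_def emeasure_path_law_cylinder[OF S P x 0])
  \<comment> \<open>On the cylinder \<open>\<omega> m = h m\<close>, so the integrand is a constant
    times the indicator.\<close>
  have "(\<integral>\<omega>. indicator (cyl m h) \<omega> * f (\<omega> (m + 0)) \<partial>path_law S P x) =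
      (\<integral>\<omega>. f (h m) * indicator (cyl m h) \<omega> \<partial>path_law S P x)"
    by (intro Bochner_Integration.integral_cong) (auto split: split_indicator)
  also have "\<dots> = f (h m) * measure (path_law S P x) (cyl m h)"
    using cyl_sets[of m h] by (simp add: sets.Int_space_eq1)
  finally show ?case by (simp add: meas)
next
  case (Suc k)
  \<comment> \<open>Partition the cylinder by the state \<open>y\<close> at time
    \<open>Suc m\<close>; writing \<open>m + Suc k\<close> as \<open>Suc m + k\<close> then makes
    the induction hypothesis apply to each piece.\<close>
  have split: "indicator (cyl m h) \<omega> = (\<Sum>y\<in>S. indicator (cyl (Suc m) (h(Suc m := y))) \<omega> :: real)"
    if \<omega>: "\<omega> \<in> space (path_law S P x)" for \<omega>
  proof -
    have "indicator (cyl (Suc m) (h(Suc m := y))) \<omega> =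
        (if y = \<omega> (Suc m) then indicator (cyl m h) \<omega> else 0 :: real)" for y
      using \<omega> by (auto simp: indicator_def le_Suc_eq)
    then show ?thesis
      using S path_law_in_S[OF \<omega>] by simp
  qed
  have "(\<integral>\<omega>. indicator (cyl m h) \<omega> * f (\<omega> (m + Suc k)) \<partial>path_law S P x) =
      (\<integral>\<omega>. (\<Sum>y\<in>S. indicator (cyl (Suc m) (h(Suc m := y))) \<omega> * f (\<omega> (Suc m + k))) \<partial>path_law S P x)"
    by (intro Bochner_Integration.integral_cong refl) (simp only: split sum_distrib_right add_Suc_shift)
  also have "\<dots> = (\<Sum>y\<in>S. \<integral>\<omega>. indicator (cyl (Suc m) (h(Suc m := y))) \<omega> * f (\<omega> (Suc m + k)) \<partial>path_law S P x)"
    by (rule Bochner_Integration.integral_sum) (rule integrable_path_law_cyl)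
  also have "\<dots> = (\<Sum>y\<in>S. (if h 0 = x then 1 else 0) * (\<Prod>i<m. P (h i) (h (Suc i))) *
      (P (h m) y * (mat_app S P ^^ k) f y))"
  proof (rule sum.cong[OF refl])
    fix y assume "y \<in> S"
    then have h: "(h(Suc m := y)) i \<in> S" if "i \<le> Suc m" for i
      using Suc.prems[of i] that by auto
    let ?h = "h(Suc m := y)"
    have "(\<integral>\<omega>. indicator (cyl (Suc m) ?h) \<omega> * f (\<omega> (Suc m + k)) \<partial>path_law S P x) =
        (if ?h 0 = x then 1 else 0) * (\<Prod>i<Suc m. P (?h i) (?h (Suc i))) * (mat_app S P ^^ k) f (?h (Suc m))"
      by (rule Suc.IH) (rule h)
    \<comment> \<open>The update touches only index \<open>Suc m\<close>: the first \<open>m\<close>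
      factors and the initial state are unchanged, and the new factor is
      \<open>P (h m) y\<close>.\<close>
    also have "\<dots> = (if h 0 = x then 1 else 0) * (\<Prod>i<m. P (h i) (h (Suc i))) * (P (h m) y * (mat_app S P ^^ k) f y)"
      by simp
    finally show "(\<integral>\<omega>. indicator (cyl (Suc m) ?h) \<omega> * f (\<omega> (Suc m + k)) \<partial>path_law S P x) =
       (if h 0 = x then 1 else 0) * (\<Prod>i<m. P (h i) (h (Suc i))) * (P (h m) y * (mat_app S P ^^ k) f y)" .
  qed
  also have "\<dots> = (if h 0 = x then 1 else 0) * (\<Prod>i<m. P (h i) (h (Suc i))) * ((mat_app S P ^^ Suc k) f (h m))"
    by (simp add: mat_app_def sum_distrib_left)
  finally show ?case .
qed

text \<open>Split by the initial state. With \<open>m = 0\<close> the product of transition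
  probabilities is empty, and only the cylinder of paths starting in \<open>x\<close>
  contributes.\<close>

lemma integral_path_law:
  "(\<integral>\<omega>. f (\<omega> k) \<partial>path_law S P x) = (mat_app S P ^^ k) f x"
proof -
  have "(\<integral>\<omega>. f (\<omega> k) \<partial>path_law S P x) =
      (\<integral>\<omega>. (\<Sum>y\<in>S. indicator (cyl 0 (\<lambda>_. y)) \<omega> * f (\<omega> (0 + k))) \<partial>path_law S P x)"
  proof (intro Bochner_Integration.integral_cong refl)
    fix \<omega> assume \<omega>: "\<omega> \<in> space (path_law S P x)"
    then have "(\<Sum>y\<in>S. indicator (cyl 0 (\<lambda>_. y)) \<omega> * f (\<omega> (0 + k))) =
        (\<Sum>y\<in>S. if y = \<omega> 0 then f (\<omega> k) else 0)"
      by (intro sum.cong) (auto simp: indicator_def)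
    then show "f (\<omega> k) = (\<Sum>y\<in>S. indicator (cyl 0 (\<lambda>_. y)) \<omega> * f (\<omega> (0 + k)))"
      using S path_law_in_S[OF \<omega>] by simp
  qed
  also have "\<dots> = (\<Sum>y\<in>S. \<integral>\<omega>. indicator (cyl 0 (\<lambda>_. y)) \<omega> * f (\<omega> (0 + k)) \<partial>path_law S P x)"
    by (rule Bochner_Integration.integral_sum) (rule integrable_path_law_cyl)
  also have "\<dots> = (\<Sum>y\<in>S. if y = x then (mat_app S P ^^ k) f y else 0)"
  proof (rule sum.cong[OF refl])
    fix y assume "y \<in> S"
    then show "(\<integral>\<omega>. indicator (cyl 0 (\<lambda>_. y)) \<omega> * f (\<omega> (0 + k)) \<partial>path_law S P x) =
        (if y = x then (mat_app S P ^^ k) f y else 0)"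
      using integral_path_law_cyl[of 0 "\<lambda>_. y" f k] by simp
  qed
  also have "\<dots> = (mat_app S P ^^ k) f x"
    using S x by simp
  finally show ?thesis .
qed

section \<open>The value as a discounted series, and its Bellman equation\<close>

lemma abs_funpow_mat_app_le:
  assumes "\<And>y. y \<in> S \<Longrightarrow> \<bar>f y\<bar> \<le> B" "y \<in> S"
  shows "\<bar>(mat_app S P ^^ k) f y\<bar> \<le> B"
  using assms(2)
proof (induction k arbitrary: y)
  case (Suc k)
  then show ?case using abs_mat_app_le[OF P Suc.prems, of "(mat_app S P ^^ k) f" B] by simp
qed (use assms(1) in simp)

text \<open>Expectation and discounted sum may be exchanged: on \<open>S\<close> the cost is bounded
  by \<open>B\<close>, so the geometric series with terms \<open>\<alpha> ^ t * B\<close> dominates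
  both pathwise and in mean.\<close>

lemma mrp_value_sums:
  assumes "0 \<le> \<alpha>" "\<alpha> < 1"
  shows "(\<lambda>t. \<alpha> ^ t * (mat_app S P ^^ t) c x) sums mrp_value S P c \<alpha> x"
proof -
  define B where "B = sup_norm_on S c"
  have B: "\<bar>c y\<bar> \<le> B" if "y \<in> S" for y
    unfolding B_def using S that by (rule abs_le_sup_norm_on)
  have geom: "summable (\<lambda>t. \<alpha> ^ t * B)"
    using assms by (intro summable_mult2 summable_geometric) simp
  have int: "integrable (path_law S P x) (\<lambda>\<omega>. \<alpha> ^ t * c (\<omega> t))" for t
    by simp
  have "AE \<omega> in path_law S P x. summable (\<lambda>t. norm (\<alpha> ^ t * c (\<omega> t)))"
    using assms B path_law_in_S
    by (intro AE_I2 summable_comparison_test'[OF geom]) (auto simp: abs_mult intro!: mult_left_mono)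
  moreover have "summable (\<lambda>t. \<integral>\<omega>. norm (\<alpha> ^ t * c (\<omega> t)) \<partial>path_law S P x)"
  proof (rule summable_comparison_test'[OF geom])
    fix t
    have "(\<integral>\<omega>. norm (\<alpha> ^ t * c (\<omega> t)) \<partial>path_law S P x) \<le> (\<integral>\<omega>. \<alpha> ^ t * B \<partial>path_law S P x)"
      using assms B path_law_in_S
      by (intro integral_mono integrable_norm int) (auto simp: abs_mult intro!: mult_left_mono)
    then show "norm (\<integral>\<omega>. norm (\<alpha> ^ t * c (\<omega> t)) \<partial>path_law S P x) \<le> \<alpha> ^ t * B"
      by (simp add: prob_space)
  qed
  ultimately have "(\<lambda>t. \<integral>\<omega>. \<alpha> ^ t * c (\<omega> t) \<partial>path_law S P x) sums mrp_value S P c \<alpha> x"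
    unfolding mrp_value_def by (intro sums_integral int)
  then show ?thesis by (simp add: integral_path_law)
qed

end

text \<open>Applying \<open>\<alpha> P\<close> to the series for the value shifts it by one term;
  restoring the term at time 0, which is \<open>c x\<close>, gives the series back, and limits are
  unique.\<close>

lemma mrp_value_bellman:
  assumes S: "finite S" and P: "row_stochastic S S P" and x: "x \<in> S" and "0 \<le> \<alpha>" "\<alpha> < 1"
  shows "mrp_value S P c \<alpha> x = c x + \<alpha> * mat_app S P (mrp_value S P c \<alpha>) x"
proof -
  note sums = mrp_value_sums[OF S P _ assms(4,5), of _ c]
  \<comment> \<open>\<open>P\<close> acts term by term because row \<open>x\<close> is a finite sum
    of convergent series.\<close>
  have "(\<lambda>t. \<Sum>y\<in>S. P x y * (\<alpha> ^ t * (mat_app S P ^^ t) c y)) sums mat_app S P (mrp_value S P c \<alpha>) x"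
    unfolding mat_app_def[of _ _ "mrp_value S P c \<alpha>"] by (intro sums_sum sums_mult sums)
  then have "(\<lambda>t. \<alpha> * (\<Sum>y\<in>S. P x y * (\<alpha> ^ t * (mat_app S P ^^ t) c y)))
      sums (\<alpha> * mat_app S P (mrp_value S P c \<alpha>) x)"
    by (rule sums_mult)
  also have "(\<lambda>t. \<alpha> * (\<Sum>y\<in>S. P x y * (\<alpha> ^ t * (mat_app S P ^^ t) c y))) =
      (\<lambda>t. \<alpha> ^ Suc t * (mat_app S P ^^ Suc t) c x)"
    by (simp add: mat_app_def[of _ _ "(mat_app S P ^^ _) c"] sum_distrib_left mult_ac)
  finally have "(\<lambda>t. \<alpha> ^ t * (mat_app S P ^^ t) c x) sums
      (\<alpha> * mat_app S P (mrp_value S P c \<alpha>) x + \<alpha> ^ 0 * (mat_app S P ^^ 0) c x)"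
    by (rule sums_Suc)
  from sums_unique2[OF sums[OF x] this] show ?thesis by simp
qed

section \<open>The error bound for coarse grid aggregation\<close>

theorem theorem2:
  fixes S :: "(int ^ 'd) set" and P :: "int ^ 'd \<Rightarrow> int ^ 'd \<Rightarrow> real"
    and c :: "int ^ 'd \<Rightarrow> real" and \<alpha> :: real
    and L :: nat and G :: "int ^ 'd \<Rightarrow> nat \<Rightarrow> real" and U :: "nat \<Rightarrow> int ^ 'd \<Rightarrow> real"
    and rep :: "nat \<Rightarrow> int ^ 'd"
    and V Vt :: "int ^ 'd \<Rightarrow> real" and W Wt :: "nat \<Rightarrow> real"
  assumes "markov_reward_process S P c \<alpha>"
    and "coarse_grid_scheme S L G U rep"
    and "\<And>x. x \<in> S \<Longrightarrow> V x = mrp_value S P c \<alpha> x"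
    and "\<And>x. x \<in> S \<Longrightarrow> Vt x = mrp_value S (lifted_chain S L P G U) c \<alpha> x"
    and "\<And>l. l \<in> {1..L} \<Longrightarrow> W l = V (rep l)"
    and "\<And>l. l \<in> {1..L} \<Longrightarrow> Wt l = Vt (rep l)"
  shows "sup_norm_on S (\<lambda>x. V x - Vt x)
    \<le> 1 / (1 - \<alpha>) * (sup_norm_on S (\<lambda>x. V x - mat_app {1..L} G W x)
                       + sup_norm_on S (\<lambda>x. Vt x - mat_app {1..L} G Wt x))"
proof -
  have S: "finite S" "S \<noteq> {}" and P: "row_stochastic S S P" and \<alpha>: "0 < \<alpha>" "\<alpha> < 1"
    using assms(1) by (auto simp: markov_reward_process_def)
  have G: "row_stochastic S {1..L} G" and U: "row_stochastic {1..L} S U"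
    and rep: "\<And>l. l \<in> {1..L} \<Longrightarrow> rep l \<in> S"
    and U_rep: "\<And>l y. l \<in> {1..L} \<Longrightarrow> y \<in> S \<Longrightarrow> U l y = (if y = rep l then 1 else 0)"
    using assms(2) by (auto simp: coarse_grid_scheme_def aggregation_scheme_def)
  \<comment> \<open>Stochasticity of \<open>P G U\<close> makes the Bellman equation available for
    \<open>Vt\<close>.\<close>
  have Pt: "row_stochastic S S (lifted_chain S L P G U)"
    unfolding lifted_chain_def by (intro row_stochastic_mat_prod[OF _ U] row_stochastic_mat_prod[OF P G])
  \<comment> \<open>Row \<open>l\<close> of \<open>U\<close> is the point mass at
    \<open>rep l\<close>.\<close>
  have U_Vt: "mat_app S U Vt l = Wt l" if "l \<in> {1..L}" for l
    using S(1) rep[OF that] assms(6)[OF that] by (simp add: mat_app_def U_rep[OF that] if_distrib[where f = "\<lambda>a. a * _"] cong: if_cong)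
  \<comment> \<open>\<open>V\<close> is known to be the value only on \<open>S\<close>, which
    suffices because \<open>mat_app S P\<close> reads its argument only there.\<close>
  have V: "V x = c x + \<alpha> * mat_app S P V x" if "x \<in> S" for x
    using mrp_value_bellman[OF S(1) P that] \<alpha> assms(3) that
    by (simp add: mat_app_cong[of S V, OF assms(3)])
  have Vt: "Vt x = c x + \<alpha> * mat_app S P (mat_app {1..L} G Wt) x" if "x \<in> S" for x
  proof -
    have "Vt x = c x + \<alpha> * mat_app S (lifted_chain S L P G U) Vt x"
      using mrp_value_bellman[OF S(1) Pt that] \<alpha> assms(4) that
      by (simp add: mat_app_cong[of S Vt, OF assms(4)])
    also have "mat_app S (lifted_chain S L P G U) Vt x = mat_app S P (mat_app {1..L} G Wt) x"
      unfolding lifted_chain_def mat_app_mat_prod using U_Vt by (intro mat_app_cong)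
    finally show ?thesis .
  qed
  let ?D = "sup_norm_on S (\<lambda>x. V x - Vt x)" and ?A = "sup_norm_on S (\<lambda>x. V x - mat_app {1..L} G W x)"
    and ?B = "sup_norm_on S (\<lambda>x. Vt x - mat_app {1..L} G Wt x)"
  \<comment> \<open>Split \<open>V - G Wt\<close> into \<open>V - G W\<close>, bounded by
    \<open>?A\<close>, and \<open>G (W - Wt)\<close>, bounded by \<open>?D\<close> since each
    \<open>rep l\<close> lies in \<open>S\<close>.\<close>
  have inner: "\<bar>V y - mat_app {1..L} G Wt y\<bar> \<le> ?A + ?D" if y: "y \<in> S" for y
  proof -
    have "\<bar>W l - Wt l\<bar> \<le> ?D" if "l \<in> {1..L}" for l
      using abs_le_sup_norm_on[OF S(1) rep[OF that], of "\<lambda>x. V x - Vt x"] assms(5,6)[OF that] by simp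
    then have "\<bar>mat_app {1..L} G (\<lambda>l. W l - Wt l) y\<bar> \<le> ?D"
      by (rule abs_mat_app_le[OF G y])
    then show ?thesis
      using abs_le_sup_norm_on[OF S(1) y, of "\<lambda>x. V x - mat_app {1..L} G W x"]
      by (simp add: mat_app_diff)
  qed
  have "?D \<le> \<alpha> * (?A + ?D)"
  proof (rule sup_norm_on_le[OF S(2)])
    fix x assume x: "x \<in> S"
    \<comment> \<open>Subtracting the two Bellman equations cancels the cost.\<close>
    have "V x - Vt x = \<alpha> * mat_app S P (\<lambda>y. V y - mat_app {1..L} G Wt y) x"
      using V[OF x] Vt[OF x] by (simp add: mat_app_diff algebra_simps)
    then show "\<bar>V x - Vt x\<bar> \<le> \<alpha> * (?A + ?D)"
      using abs_mat_app_le[OF P x inner] \<alpha> by (simp add: abs_mult mult_left_mono)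
  qed
  \<comment> \<open>Absorbing \<open>\<alpha> * ?D\<close> on the left leaves
    \<open>(1 - \<alpha>) * ?D \<le> \<alpha> * ?A\<close>; these two facts relax the right side to
    \<open>?A + ?B\<close>.\<close>
  moreover have "\<alpha> * ?A \<le> ?A" "0 \<le> ?B"
    using sup_norm_on_nonneg[OF S] \<alpha> by (auto intro!: mult_left_le_one_le)
  ultimately have "(1 - \<alpha>) * ?D \<le> ?A + ?B"
    by (simp add: algebra_simps)
  then show ?thesis
    using \<alpha> by (simp add: pos_le_divide_eq mult.commute)
qed

end
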